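(* Consider the initial value problem on the metric graph $\Gamma=(\mathcal V,\mathcal E,\lambda)$ described in the context, with fixed dissipation functions $f_{ij}$ and compatibility functions $\underline\alpha_{ij},\overline\alpha_{ij}$, and suppose that Assumption A of the context is satisfied for each of the two sets of data considered below. Suppose that for every $(i,j)\in\mathcal E$ the dissipation function $f_{ij}(t,u,v)$ is strictly increasing in its third argument $v$. For $m=1,2$ let $\rho^{(m)}_{ij},\phi^{(m)}_{ij}$ (for $(i,j)\in\mathcal E$), together with the internal nodal densities $\rho^{(m)}_i$ (for $i\in\mathcal V$), be the classical solution corresponding to initial density profiles $\rho^{(m)}_{ij}(0,\cdot)$, initial flow profiles $\phi_{ij}^{(m)}(0,\cdot)$ and nodal parameter functions $q^{(m)}_i$. Suppose that $\rho^{(1)}_{ij}(0,x_{ij})\ge\rho^{(2)}_{ij}(0,x_{ij})$ for all $(i,j)\in\mathcal E$ and all $x_{ij}\in I_{ij}$. Let $\mathcal S\subseteq\mathcal V$ be an arbitrary subset and let $t_0\in[0,T]$. Suppose that $q^{(1)}_i(t)\ge q^{(2)}_i(t)$ for all $i\in\mathcal S$ and all $t\in[0,t_0]$, and that $\rho^{(1)}_i(t)\ge\rho^{(2)}_i(t)$ for all $i\in\mathcal V\setminus\mathcal S$ and all $t\in[0,t_0]$. Then $$\rho^{(1)}_{ij}(t,x_{ij})\ge\rho^{(2)}_{ij}(t,x_{ij})\qquad\text{for all }(i,j)\in\mathcal E,\ x_{ij}\in I_{ij},\ t\in[0,t_0].$$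
   Context: Graph. $\Gamma=(\mathcal V,\mathcal E,\lambda)$ is a metric graph with (finite) vertex set $\mathcal V$, directed edge set $\mathcal E\subset\mathcal V\times\mathcal V$ and edge lengths $L_{ij}=\lambda(i,j)>0$. Each edge $(i,j)\in\mathcal E$ carries the interval $I_{ij}=[0,L_{ij}]$. For $j\in\mathcal V$, $\partial_+j=\{i\in\mathcal V:(i,j)\in\mathcal E\}$ and $\partial_-j=\{k\in\mathcal V:(j,k)\in\mathcal E\}$. $\mathbb R_+$ denotes the non-negative reals and $T>0$ is fixed. Unknowns. On each edge: a density $\rho_{ij}:[0,T]\times I_{ij}\to\mathbb R_+$ and a flow $\phi_{ij}:[0,T]\times I_{ij}\to\mathbb R$. At each vertex: an internal nodal density $\rho_i:[0,T]\to\mathbb R_+$. Nodal parameter functions (injections) $q_i:[0,T]\to\mathbb R$ are given. Initial value problem. For each edge $(i,j)\in\mathcal E$, $$\partial_t\rho_{ij}(t,x)+\partial_x\phi_{ij}(t,x)=0,\qquad \phi_{ij}(t,x)+f_{ij}\big(t,\rho_{ij}(t,x),\partial_x\rho_{ij}(t,x)\big)=0,$$ where $f_{ij}=f_{ij}(t,u,v)$ is a given real-valued dissipation function. With the notation $\underline\rho_{ij}(t)=\rho_{ij}(t,0)$, $\overline\rho_{ij}(t)=\rho_{ij}(t,L_{ij})$, $\underline\phi_{ij}(t)=\phi_{ij}(t,0)$, $\overline\phi_{ij}(t)=\phi_{ij}(t,L_{ij})$, the nodal conditions are $$q_j(t)+\sum_{i\in\partial_+j}\overline\phi_{ij}(t)-\sum_{k\in\partial_-j}\underline\phi_{jk}(t)=0\quad\text{for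 all }j\in\mathcal V,$$ $$\underline\rho_{ij}(t)=\underline\alpha_{ij}(t,\rho_i(t)),\qquad \overline\rho_{ij}(t)=\overline\alpha_{ij}(t,\rho_j(t))\quad\text{for all }(i,j)\in\mathcal E,$$ where the compatibility functions $\underline\alpha_{ij}(t,\rho),\overline\alpha_{ij}(t,\rho)$ are strictly increasing in $\rho>0$ for every $t\in[0,T]$. The initial conditions are $\rho_{ij}(0,x)=\rho^0_{ij}(x)$ and $\phi_{ij}(0,x)=\phi^0_{ij}(x)$ for all $(i,j)\in\mathcal E$. Assumption A. (i) There is an integer $k\ge2$ such that $\rho^0_{ij},\phi^0_{ij}\in C^k([0,L_{ij}])$ for all $(i,j)\in\mathcal E$, and the nodal conditions above hold at $t=0$. (ii) The compatibility functions $\underline\alpha_{ij},\overline\alpha_{ij}$ are non-negative functions of class $C^k$ on $[0,T]\times\mathbb R_+$ for all $(i,j)\in\mathcal E$, and $q_i\in C^k([0,T])$ for all $i\in\mathcal V$. (iii) The initial value problem admits a unique classical solution, and it is twice continuously differentiable. (iv) (Stability under small perturbations.) Let $\rho_{ij},\phi_{ij}$ be the unique classical solution of the initial value problem. For (sufficiently small) $\epsilon>0$ let $\rho_{ij,\epsilon},\phi_{ij,\epsilon}$ be a (twice continuously differentiable) solution of the perturbed system $$\partial_t\rho_{ij,\epsilon}+\partial_x\phi_{ij,\epsilon}-\epsilon=0,\qquad \phi_{ij,\epsilon}+f_{ij}(t,\rho_{ij,\epsilon},\partial_x\rho_{ij,\epsilon})=0,$$ with the same nodal conditions and the same $q_i$,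 and with perturbed initial conditions $\rho_{ij,\epsilon}(0,x)=\rho^0_{ij}(x)+\epsilon$, $\phi_{ij,\epsilon}(0,x)=\phi^0_{ij}(x)$; such solutions are taken to exist. Then $\lim_{\epsilon\to0}\rho_{ij,\epsilon}(t,x)=\rho_{ij}(t,x)$ for all $(i,j)\in\mathcal E$, $x\in I_{ij}$, $t\in[0,T]$. *)

theory Defs
  imports "HOL-Analysis.Analysis"
begin

text \<open>
  Class \<open>C\<^sup>k\<close> on a set that need not be open: derivatives are taken within \<open>S\<close>, hence are one-sided
  at the boundary. \<open>D x\<close> is the gradient of \<open>g\<close> at \<open>x\<close>. It is unique on the sets used below, which
  are intervals of positive length and products of two such intervals.
\<close>
primrec Ck_on :: "nat \<Rightarrow> 'a::euclidean_space set \<Rightarrow> ('a \<Rightarrow> real) \<Rightarrow> bool" where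
  "Ck_on 0 S g \<longleftrightarrow> continuous_on S g"
| "Ck_on (Suc k) S g \<longleftrightarrow>
     (\<exists>D :: 'a \<Rightarrow> 'a.
        (\<forall>x\<in>S. (g has_derivative (\<lambda>h. D x \<bullet> h)) (at x within S)) \<and>
        (\<forall>b\<in>Basis. Ck_on k S (\<lambda>x. D x \<bullet> b)))"

text \<open>
  \<open>compat_lo\<close> and \<open>compat_hi\<close> are the compatibility functions \<open>\<alpha>\<close> with an underline (start of the
  edge, \<open>x = 0\<close>) and an overline (end of the edge, \<open>x = L\<close>), with arguments edge, time, density.
  The arguments of \<open>dissip\<close> are edge, \<open>t\<close>, \<open>u\<close>, \<open>v\<close>.
\<close>
record 'v network =
  verts :: "'v set"
  edges :: "('v \<times> 'v) set"
  len :: "'v \<times> 'v \<Rightarrow> real"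
  horizon :: real
  dissip :: "'v \<times> 'v \<Rightarrow> real \<Rightarrow> real \<Rightarrow> real \<Rightarrow> real"
  compat_lo :: "'v \<times> 'v \<Rightarrow> real \<Rightarrow> real \<Rightarrow> real"
  compat_hi :: "'v \<times> 'v \<Rightarrow> real \<Rightarrow> real \<Rightarrow> real"

definition flow_network :: "'v network \<Rightarrow> bool" where
  "flow_network G \<longleftrightarrow>
     finite (verts G) \<and> edges G \<subseteq> verts G \<times> verts G \<and>
     (\<forall>e\<in>edges G. 0 < len G e) \<and> 0 < horizon G \<and>
     (\<forall>e\<in>edges G. \<forall>t\<in>{0..horizon G}.
        strict_mono_on {0<..} (compat_lo G e t) \<and> strict_mono_on {0<..} (compat_hi G e t))"

text \<open>
  The nodal conditions at one instant \<open>t\<close>: here \<open>q\<close>, \<open>\<rho>\<close>, \<open>\<phi>\<close>, \<open>r\<close> are the injections, the density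
  and flow profiles along the edges, and the internal nodal densities at that instant.
\<close>
definition nodal_conditions ::
  "'v network \<Rightarrow> real \<Rightarrow> ('v \<Rightarrow> real) \<Rightarrow> ('v \<times> 'v \<Rightarrow> real \<Rightarrow> real) \<Rightarrow> ('v \<times> 'v \<Rightarrow> real \<Rightarrow> real)
    \<Rightarrow> ('v \<Rightarrow> real) \<Rightarrow> bool" where
  "nodal_conditions G t q \<rho> \<phi> r \<longleftrightarrow>
     (\<forall>j\<in>verts G.
        q j + (\<Sum>i | (i, j) \<in> edges G. \<phi> (i, j) (len G (i, j)))
            - (\<Sum>k | (j, k) \<in> edges G. \<phi> (j, k) 0) = 0) \<and>
     (\<forall>(i, j)\<in>edges G.
        \<rho> (i, j) 0 = compat_lo G (i, j) t (r i) \<and>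
        \<rho> (i, j) (len G (i, j)) = compat_hi G (i, j) t (r j))"

text \<open>
  The edge equations with source term \<open>\<epsilon>\<close>; the unperturbed system is \<open>\<epsilon> = 0\<close>.
  \<open>\<rho>t\<close>, \<open>\<rho>x\<close>, \<open>\<phi>x\<close> are the partial derivatives at \<open>(t, x)\<close>.
\<close>
definition edge_equations ::
  "'v network \<Rightarrow> real \<Rightarrow> ('v \<times> 'v \<Rightarrow> real \<Rightarrow> real \<Rightarrow> real) \<Rightarrow> ('v \<times> 'v \<Rightarrow> real \<Rightarrow> real \<Rightarrow> real) \<Rightarrow> bool" where
  "edge_equations G \<epsilon> \<rho> \<phi> \<longleftrightarrow>
     (\<forall>e\<in>edges G. \<forall>t\<in>{0..horizon G}. \<forall>x\<in>{0..len G e}. \<exists>\<rho>t \<rho>x \<phi>x.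
        ((\<lambda>s. \<rho> e s x) has_real_derivative \<rho>t) (at t within {0..horizon G}) \<and>
        ((\<lambda>y. \<rho> e t y) has_real_derivative \<rho>x) (at x within {0..len G e}) \<and>
        ((\<lambda>y. \<phi> e t y) has_real_derivative \<phi>x) (at x within {0..len G e}) \<and>
        \<rho>t + \<phi>x - \<epsilon> = 0 \<and>
        \<phi> e t x + dissip G e t (\<rho> e t x) \<rho>x = 0)"

definition regular ::
  "'v network \<Rightarrow> nat \<Rightarrow> ('v \<times> 'v \<Rightarrow> real \<Rightarrow> real \<Rightarrow> real) \<Rightarrow> ('v \<times> 'v \<Rightarrow> real \<Rightarrow> real \<Rightarrow> real) \<Rightarrow> bool" where
  "regular G k \<rho> \<phi> \<longleftrightarrow>
     (\<forall>e\<in>edges G.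
        Ck_on k ({0..horizon G} \<times> {0..len G e}) (\<lambda>(t, x). \<rho> e t x) \<and>
        Ck_on k ({0..horizon G} \<times> {0..len G e}) (\<lambda>(t, x). \<phi> e t x))"

definition ivp_solution ::
  "'v network \<Rightarrow> real \<Rightarrow> ('v \<Rightarrow> real \<Rightarrow> real) \<Rightarrow> ('v \<times> 'v \<Rightarrow> real \<Rightarrow> real) \<Rightarrow> ('v \<times> 'v \<Rightarrow> real \<Rightarrow> real)
    \<Rightarrow> ('v \<times> 'v \<Rightarrow> real \<Rightarrow> real \<Rightarrow> real) \<Rightarrow> ('v \<times> 'v \<Rightarrow> real \<Rightarrow> real \<Rightarrow> real) \<Rightarrow> ('v \<Rightarrow> real \<Rightarrow> real)
    \<Rightarrow> bool" where
  "ivp_solution G \<epsilon> q \<rho>0 \<phi>0 \<rho> \<phi> r \<longleftrightarrow>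
     (\<forall>e\<in>edges G. \<forall>t\<in>{0..horizon G}. \<forall>x\<in>{0..len G e}. 0 \<le> \<rho> e t x) \<and>
     (\<forall>i\<in>verts G. \<forall>t\<in>{0..horizon G}. 0 \<le> r i t) \<and>
     edge_equations G \<epsilon> \<rho> \<phi> \<and>
     (\<forall>t\<in>{0..horizon G}.
        nodal_conditions G t (\<lambda>i. q i t) (\<lambda>e. \<rho> e t) (\<lambda>e. \<phi> e t) (\<lambda>i. r i t)) \<and>
     (\<forall>e\<in>edges G. \<forall>x\<in>{0..len G e}. \<rho> e 0 x = \<rho>0 e x \<and> \<phi> e 0 x = \<phi>0 e x)"

definition classical_solution ::
  "'v network \<Rightarrow> ('v \<Rightarrow> real \<Rightarrow> real) \<Rightarrow> ('v \<times> 'v \<Rightarrow> real \<Rightarrow> real) \<Rightarrow> ('v \<times> 'v \<Rightarrow> real \<Rightarrow> real)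
    \<Rightarrow> ('v \<times> 'v \<Rightarrow> real \<Rightarrow> real \<Rightarrow> real) \<Rightarrow> ('v \<times> 'v \<Rightarrow> real \<Rightarrow> real \<Rightarrow> real) \<Rightarrow> ('v \<Rightarrow> real \<Rightarrow> real)
    \<Rightarrow> bool" where
  "classical_solution G q \<rho>0 \<phi>0 \<rho> \<phi> r \<longleftrightarrow> regular G 1 \<rho> \<phi> \<and> ivp_solution G 0 q \<rho>0 \<phi>0 \<rho> \<phi> r"

definition perturbed_solution ::
  "'v network \<Rightarrow> real \<Rightarrow> ('v \<Rightarrow> real \<Rightarrow> real) \<Rightarrow> ('v \<times> 'v \<Rightarrow> real \<Rightarrow> real) \<Rightarrow> ('v \<times> 'v \<Rightarrow> real \<Rightarrow> real)
    \<Rightarrow> ('v \<times> 'v \<Rightarrow> real \<Rightarrow> real \<Rightarrow> real) \<Rightarrow> ('v \<times> 'v \<Rightarrow> real \<Rightarrow> real \<Rightarrow> real) \<Rightarrow> ('v \<Rightarrow> real \<Rightarrow> real)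
    \<Rightarrow> bool" where
  "perturbed_solution G \<epsilon> q \<rho>0 \<phi>0 \<rho> \<phi> r \<longleftrightarrow>
     regular G 2 \<rho> \<phi> \<and> ivp_solution G \<epsilon> q (\<lambda>e x. \<rho>0 e x + \<epsilon>) \<phi>0 \<rho> \<phi> r"

definition initial_data_ok ::
  "'v network \<Rightarrow> nat \<Rightarrow> ('v \<Rightarrow> real \<Rightarrow> real) \<Rightarrow> ('v \<times> 'v \<Rightarrow> real \<Rightarrow> real) \<Rightarrow> ('v \<times> 'v \<Rightarrow> real \<Rightarrow> real)
    \<Rightarrow> bool" where
  "initial_data_ok G k q \<rho>0 \<phi>0 \<longleftrightarrow>
     (\<forall>e\<in>edges G. Ck_on k {0..len G e} (\<rho>0 e) \<and> Ck_on k {0..len G e} (\<phi>0 e)) \<and>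
     (\<exists>r. (\<forall>i\<in>verts G. 0 \<le> r i) \<and> nodal_conditions G 0 (\<lambda>i. q i 0) \<rho>0 \<phi>0 r)"

definition parameters_ok :: "'v network \<Rightarrow> nat \<Rightarrow> ('v \<Rightarrow> real \<Rightarrow> real) \<Rightarrow> bool" where
  "parameters_ok G k q \<longleftrightarrow>
     (\<forall>e\<in>edges G.
        (\<forall>t\<in>{0..horizon G}. \<forall>u\<ge>0. 0 \<le> compat_lo G e t u \<and> 0 \<le> compat_hi G e t u) \<and>
        Ck_on k ({0..horizon G} \<times> {0..}) (\<lambda>(t, u). compat_lo G e t u) \<and>
        Ck_on k ({0..horizon G} \<times> {0..}) (\<lambda>(t, u). compat_hi G e t u)) \<and>
     (\<forall>i\<in>verts G. Ck_on k {0..horizon G} (q i))"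

text \<open>
  Uniqueness concerns densities and flows on the edges, on their domain; the internal density of a
  vertex without incident edges is not determined by the system.
\<close>
definition well_posed ::
  "'v network \<Rightarrow> ('v \<Rightarrow> real \<Rightarrow> real) \<Rightarrow> ('v \<times> 'v \<Rightarrow> real \<Rightarrow> real) \<Rightarrow> ('v \<times> 'v \<Rightarrow> real \<Rightarrow> real) \<Rightarrow> bool" where
  "well_posed G q \<rho>0 \<phi>0 \<longleftrightarrow>
     (\<exists>\<rho> \<phi> r. classical_solution G q \<rho>0 \<phi>0 \<rho> \<phi> r \<and> regular G 2 \<rho> \<phi> \<and>
        (\<forall>\<rho>' \<phi>' r'. classical_solution G q \<rho>0 \<phi>0 \<rho>' \<phi>' r' \<longrightarrow>
           (\<forall>e\<in>edges G. \<forall>t\<in>{0..horizon G}. \<forall>x\<in>{0..len G e}.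
              \<rho>' e t x = \<rho> e t x \<and> \<phi>' e t x = \<phi> e t x)))"

text \<open>
  Perturbed solutions exist for all sufficiently small \<open>\<epsilon> > 0\<close>, and every family of them, indexed by
  \<open>\<epsilon>\<close>, converges pointwise to the unperturbed solution.
\<close>
definition stable ::
  "'v network \<Rightarrow> ('v \<Rightarrow> real \<Rightarrow> real) \<Rightarrow> ('v \<times> 'v \<Rightarrow> real \<Rightarrow> real) \<Rightarrow> ('v \<times> 'v \<Rightarrow> real \<Rightarrow> real) \<Rightarrow> bool" where
  "stable G q \<rho>0 \<phi>0 \<longleftrightarrow>
     (\<forall>\<^sub>F \<epsilon> in at_right 0. \<exists>\<rho> \<phi> r. perturbed_solution G \<epsilon> q \<rho>0 \<phi>0 \<rho> \<phi> r) \<and>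
     (\<forall>\<rho> \<phi> r \<rho>\<epsilon> \<phi>\<epsilon> r\<epsilon>.
        classical_solution G q \<rho>0 \<phi>0 \<rho> \<phi> r \<longrightarrow>
        (\<forall>\<^sub>F \<epsilon> in at_right 0. perturbed_solution G \<epsilon> q \<rho>0 \<phi>0 (\<rho>\<epsilon> \<epsilon>) (\<phi>\<epsilon> \<epsilon>) (r\<epsilon> \<epsilon>)) \<longrightarrow>
        (\<forall>e\<in>edges G. \<forall>t\<in>{0..horizon G}. \<forall>x\<in>{0..len G e}.
           ((\<lambda>\<epsilon>. \<rho>\<epsilon> \<epsilon> e t x) \<longlongrightarrow> \<rho> e t x) (at_right 0)))"

definition assumption_A ::
  "'v network \<Rightarrow> ('v \<Rightarrow> real \<Rightarrow> real) \<Rightarrow> ('v \<times> 'v \<Rightarrow> real \<Rightarrow> real) \<Rightarrow> ('v \<times> 'v \<Rightarrow> real \<Rightarrow> real) \<Rightarrow> bool" where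
  "assumption_A G q \<rho>0 \<phi>0 \<longleftrightarrow>
     (\<exists>k\<ge>2. initial_data_ok G k q \<rho>0 \<phi>0 \<and> parameters_ok G k q) \<and>
     well_posed G q \<rho>0 \<phi>0 \<and> stable G q \<rho>0 \<phi>0"

end

theory Submission
  imports Defs
begin

text \<open>
  The total excess \<open>M t = \<Sum>e. \<integral> max 0 (\<rho>2 - \<rho>1)\<close> does not increase in time, and it vanishes at \<open>t = 0\<close>.
  Indeed its derivative is the integral of \<open>-(\<phi>2 - \<phi>1)\<^sub>x\<close> over the open set where \<open>\<rho>2 > \<rho>1\<close>. At an endpoint
  of a component of this set inside an edge the densities agree, so monotonicity of the dissipation in the
  density gradient gives \<open>\<phi>2 - \<phi>1\<close> the sign that makes the contribution nonpositive. At the vertices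
  the sign of \<open>\<rho>2 - \<rho>1\<close> is the same on all incident edges, and the contributions add up to the sum of
  \<open>q2 - q1\<close> over the vertices with \<open>r1 < r2\<close>, which all lie in \<open>S\<close>.
\<close>

section \<open>Integrals over open subsets of the line\<close>

lemma bounded_open_connected_real:
  fixes C :: "real set"
  assumes "open C" "connected C" "bounded C" "C \<noteq> {}"
  obtains a b where "a < b" "C = {a<..<b}"
proof -
  have bb: "bdd_below C" "bdd_above C"
    using assms(3) by (auto intro: bounded_imp_bdd_below bounded_imp_bdd_above)
  obtain l u where "\<And>x. x \<in> C \<Longrightarrow> l \<le> x" "\<And>x. x \<in> C \<Longrightarrow> x \<le> u"
    using bb by (auto simp: bdd_below_def bdd_above_def)
  then have ends: "Inf C \<notin> C" "Sup C \<notin> C"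
    using Inf_notin_open[OF assms(1), of "l - 1"] Sup_notin_open[OF assms(1), of "u + 1"] by force+
  have "C = {Inf C<..<Sup C}"
  proof
    show "C \<subseteq> {Inf C<..<Sup C}"
      using bb ends by (force simp: less_le intro: cInf_lower cSup_upper)
    show "{Inf C<..<Sup C} \<subseteq> C"
    proof
      fix x assume x: "x \<in> {Inf C<..<Sup C}"
      obtain y z where "y \<in> C" "y < x" "z \<in> C" "x < z"
        using x assms(4) bb by (auto simp: cInf_less_iff less_cSup_iff)
      then show "x \<in> C"
        using assms(2) by (meson connected_iff_interval less_imp_le)
    qed
  qed
  then show thesis
    using that assms(4) by (metis greaterThanLessThan_empty not_le)
qed

text \<open>The components of \<open>U\<close> are countably many disjoint open intervals, and
  \<open>comp\<close> covers each of them because the ends of a component lie outside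
  \<open>U\<close>. Absolute integrability makes the integral countably additive over the
  components.\<close>

lemma integral_open_nonneg:
  fixes g :: "real \<Rightarrow> real"
  assumes U: "open U" "bounded U" and g: "g absolutely_integrable_on U"
    and comp: "\<And>a b. \<lbrakk>a < b; {a<..<b} \<subseteq> U; a \<notin> U; b \<notin> U\<rbrakk> \<Longrightarrow> 0 \<le> integral {a<..<b} g"
  shows "0 \<le> integral U g"
proof -
  let ?K = "components U"
  have op: "open C" if "C \<in> ?K" for C
    using that U(1) open_components by blast
  have "countable ?K"
    using op pairwise_disjoint_components[of U]
    by (intro countable_disjoint_open_subsets) (auto simp: disjnt_def[abs_def])
  \<comment> \<open>This treats finitely and infinitely many components alike: an index that belongs
    to no component gives the empty union, which contributes 0.\<close>
  define A where "A = (\<lambda>i::nat. \<Union>{C\<in>?K. to_nat_on ?K C = i})"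
  have A_cases: "A i = {} \<or> A i \<in> ?K" for i
  proof (cases "\<exists>C\<in>?K. to_nat_on ?K C = i")
    case True
    then obtain C where "C \<in> ?K" "to_nat_on ?K C = i" by blast
    then have "{C\<in>?K. to_nat_on ?K C = i} = {C}"
      using \<open>countable ?K\<close> by (auto dest: inj_onD[OF inj_on_to_nat_on])
    with \<open>C \<in> ?K\<close> show ?thesis by (simp add: A_def)
  qed (auto simp: A_def)
  have A_sets: "A i \<in> sets lebesgue" for i
    using A_cases[of i] op by auto
  have A_disj: "A i \<inter> A j = {}" if "i \<noteq> j" for i j
    using that components_eq by (fastforce simp: A_def)
  have "(\<Union>i. A i) = \<Union>?K"
    unfolding A_def by blast
  then have A_Un: "(\<Union>i. A i) = U"
    by simp
  have gA: "g absolutely_integrable_on A i" for i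
    by (rule set_integrable_subset[OF g]) (use A_sets A_Un in auto)
  have nonneg: "0 \<le> (LINT x:A i|lebesgue. g x)" for i
  proof (cases "A i = {}")
    case False
    with A_cases have C: "A i \<in> ?K" by blast
    then have "bounded (A i)"
      using U(2) bounded_subset in_components_subset by blast
    then obtain a b where ab: "a < b" "A i = {a<..<b}"
      using C False bounded_open_connected_real[of "A i"] op in_components_connected by metis
    have out: "c \<notin> U" if "c \<in> {a, b}" for c
    proof
      assume "c \<in> U"
      \<comment> \<open>Adding an endpoint keeps the interval connected. If that endpoint were in
        \<open>U\<close>, maximality of the component would force it into the open interval
        itself.\<close>
      moreover have "connected (insert c {a<..<b})"
        by (rule connected_intermediate_closure[of "{a<..<b}"]) (use ab that in auto)
      ultimately have "insert c {a<..<b} \<subseteq> {a<..<b}"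
        using components_maximal[OF C] ab in_components_subset[OF C]
        by (metis Int_insert_right_if0 False Int_absorb1 Int_commute inf.idem insert_subset subset_insertI)
      then show False using that by auto
    qed
    have "0 \<le> integral {a<..<b} g"
      by (rule comp) (use ab out in_components_subset[OF C] in auto)
    then show ?thesis
      using set_lebesgue_integral_eq_integral(2)[OF gA[of i]] ab by simp
  qed (simp add: set_lebesgue_integral_def)
  have fin: "(LINT x:(\<Union>i\<in>{..<n}. A i)|lebesgue. g x) = (\<Sum>i<n. LINT x:A i|lebesgue. g x)" for n
    by (rule set_integral_finite_Union)
      (use A_sets A_disj gA in \<open>auto simp: disjoint_family_on_def\<close>)
  have "(\<lambda>n. LINT x:(\<Union>i\<in>{..<n}. A i)|lebesgue. g x) \<longlonglongrightarrow> (LINT x:(\<Union>n. \<Union>i\<in>{..<n}. A i)|lebesgue. g x)"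
  proof (rule set_integral_cont_up)
    show "incseq (\<lambda>n. \<Union>i\<in>{..<n}. A i)" by (force simp: incseq_def)
    have "(\<Union>n. \<Union>i\<in>{..<n}. A i) = U" using A_Un by auto
    then show "set_integrable lebesgue (\<Union>n. \<Union>i\<in>{..<n}. A i) g" using g by simp
  qed (use A_sets in auto)
  moreover have "(\<Union>n. \<Union>i\<in>{..<n}. A i) = U" using A_Un by auto
  ultimately have "(\<lambda>n. \<Sum>i<n. LINT x:A i|lebesgue. g x) \<longlonglongrightarrow> integral U g"
    using set_lebesgue_integral_eq_integral(2)[OF g] fin by simp
  then show ?thesis
    by (rule LIMSEQ_le_const) (use nonneg in \<open>auto intro: sum_nonneg\<close>)
qed

section \<open>Ends of positivity intervals, and monotonicity from one-sided bounds\<close>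

text \<open>Continuity forces \<open>v a \<ge> 0\<close>, after which all difference quotients from
  the right are positive. Restricting the derivative to \<open>{a<..<c}\<close> means that an end of
  an edge, where \<open>D\<close> is only one-sided, needs no separate treatment.\<close>

lemma zero_and_deriv_at_left_end:
  fixes v :: "real \<Rightarrow> real"
  assumes "(v has_real_derivative D) (at a within S)" "a < c" "{a<..<c} \<subseteq> S"
    and pos: "\<And>x. x \<in> {a<..<c} \<Longrightarrow> 0 < v x" and "v a \<le> 0"
  shows "v a = 0 \<and> 0 \<le> D"
proof -
  let ?F = "at a within {a<..<c}"
  have nb: "?F \<noteq> bot"
    using assms(2) by (simp add: at_within_eq_bot_iff)
  have D: "(v has_real_derivative D) ?F"
    using assms(1,3) has_field_derivative_subset by blast
  have "(v \<longlongrightarrow> v a) ?F"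
    using D by (meson DERIV_isCont has_field_derivative_def has_derivative_continuous continuous_within)
  then have va: "v a = 0"
    using tendsto_lowerbound[of v "v a" ?F 0] nb pos assms(5)
    by (force simp: eventually_at_filter less_imp_le)
  have "((\<lambda>x. (v x - v a) / (x - a)) \<longlongrightarrow> D) ?F"
    using D by (simp add: has_field_derivative_iff)
  then have "0 \<le> D"
    by (rule tendsto_lowerbound) (use nb pos va in \<open>auto simp: eventually_at_filter less_imp_le\<close>)
  with va show ?thesis by simp
qed

lemma zero_and_deriv_at_right_end:
  fixes v :: "real \<Rightarrow> real"
  assumes "(v has_real_derivative D) (at a within S)" "c < a" "{c<..<a} \<subseteq> S"
    and pos: "\<And>x. x \<in> {c<..<a} \<Longrightarrow> 0 < v x" and "v a \<le> 0"
  shows "v a = 0 \<and> D \<le> 0"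
proof -
  let ?F = "at a within {c<..<a}"
  have nb: "?F \<noteq> bot"
    using assms(2) by (simp add: at_within_eq_bot_iff)
  have D: "(v has_real_derivative D) ?F"
    using assms(1,3) has_field_derivative_subset by blast
  have "(v \<longlongrightarrow> v a) ?F"
    using D by (meson has_field_derivative_def has_derivative_continuous continuous_within)
  then have va: "v a = 0"
    using tendsto_lowerbound[of v "v a" ?F 0] nb pos assms(5)
    by (force simp: eventually_at_filter less_imp_le)
  have "((\<lambda>x. (v x - v a) / (x - a)) \<longlongrightarrow> D) ?F"
    using D by (simp add: has_field_derivative_iff)
  then have "D \<le> 0"
    by (rule tendsto_upperbound)
      (use nb pos va in \<open>auto simp: eventually_at_filter less_imp_le divide_nonneg_nonpos\<close>)
  with va show ?thesis by simp
qed

text \<open>Differentiability of \<open>M\<close> is not assumed: \<open>loc\<close> says only that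
  the upper left Dini derivative is nonpositive. Since \<open>max 0\<close> has a kink, this is the
  form of decrease that the excess is shown to satisfy.\<close>

lemma left_nonincreasing_imp_le:
  fixes M :: "real \<Rightarrow> real"
  assumes cont: "continuous_on {a..b} M" and "a \<le> b"
    and loc: "\<And>t e. t \<in> {a<..b} \<Longrightarrow> 0 < e \<Longrightarrow>
      \<exists>s0. a \<le> s0 \<and> s0 < t \<and> (\<forall>s\<in>{s0<..<t}. M t - M s \<le> e * (t - s))"
  shows "M b \<le> M a"
proof (rule ccontr)
  assume "\<not> M b \<le> M a"
  then have "a < b" using \<open>a \<le> b\<close> by (cases "a = b") auto
  \<comment> \<open>Half the mean slope of \<open>M\<close>: subtracting this tilt still leaves a
    function that is larger at \<open>b\<close> than at \<open>a\<close>.\<close>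
  define e where "e = (M b - M a) / (2 * (b - a))"
  have e: "0 < e" "M b - e * b > M a - e * a"
  proof -
    show "0 < e"
      using \<open>\<not> M b \<le> M a\<close> \<open>a < b\<close> by (simp add: e_def)
    have "e * (b - a) = (M b - M a) / 2"
      using \<open>a < b\<close> unfolding e_def by (simp add: divide_simps)
    then show "M b - e * b > M a - e * a"
      using \<open>\<not> M b \<le> M a\<close> by (simp add: algebra_simps)
  qed
  \<comment> \<open>the first time at which \<open>N\<close> reaches its final value contradicts \<open>loc\<close>\<close>
  define N where "N = (\<lambda>t. M t - e * t)"
  define Z where "Z = {t \<in> {a..b}. N b \<le> N t}"
  have contN: "continuous_on {a..b} N"
    unfolding N_def by (intro continuous_intros cont)
  have "closed Z"
    unfolding Z_def using continuous_closed_preimage[OF contN, of "{N b..}"]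
    by (simp add: vimage_def Int_def)
  moreover have "b \<in> Z" "bdd_below Z" 
    using \<open>a < b\<close> by (auto simp: Z_def intro: bdd_belowI[of _ a])
  ultimately have iZ: "Inf Z \<in> Z"
    using closed_contains_Inf by blast
  define t where "t = Inf Z"
  have "t \<noteq> a" using iZ e(2) by (auto simp: Z_def N_def t_def)
  then have t: "t \<in> {a<..b}" "N b \<le> N t" using iZ by (auto simp: Z_def t_def)
  obtain s0 where s0: "a \<le> s0" "s0 < t" "\<And>s. s \<in> {s0<..<t} \<Longrightarrow> M t - M s \<le> e * (t - s)"
    using loc[OF t(1) e(1)] by blast
  define s where "s = (s0 + t) / 2"
  have s: "s \<in> {s0<..<t}" using s0 by (auto simp: s_def)
  have "N t \<le> N s" using s0(3)[OF s] by (simp add: N_def algebra_simps)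
  then have "s \<in> Z" using s s0 t by (auto simp: Z_def)
  then have "t \<le> s" unfolding t_def using \<open>bdd_below Z\<close> by (rule cInf_lower)
  with s show False by simp
qed

section \<open>Flux balance on the positivity set along one edge\<close>

text \<open>Over a component of \<open>{v > 0}\<close> the integral of \<open>h\<close> is the
  increment of \<open>\<Phi>\<close>. At a left end where \<open>v\<close> vanishes the slope is
  nonnegative, so \<open>up\<close> gives \<open>\<Phi> \<le> 0\<close>; at such a right end
  \<open>down\<close> gives \<open>\<Phi> \<ge> 0\<close>. Hence every such end contributes with a
  favourable sign, and boundary terms remain only where \<open>v\<close> is positive at
  \<open>0\<close> or \<open>L\<close>.\<close>

lemma positive_part_flux:
  fixes v \<Phi> h v' :: "real \<Rightarrow> real"
  assumes "0 < L"
    and dv: "\<And>x. x \<in> {0..L} \<Longrightarrow> (v has_real_derivative v' x) (at x within {0..L})"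
    and d\<Phi>: "\<And>x. x \<in> {0..L} \<Longrightarrow> (\<Phi> has_real_derivative h x) (at x within {0..L})"
    and h: "continuous_on {0..L} h"
    and up: "\<And>x. x \<in> {0..L} \<Longrightarrow> v x = 0 \<Longrightarrow> 0 \<le> v' x \<Longrightarrow> \<Phi> x \<le> 0"
    and down: "\<And>x. x \<in> {0..L} \<Longrightarrow> v x = 0 \<Longrightarrow> v' x \<le> 0 \<Longrightarrow> 0 \<le> \<Phi> x"
  shows "(\<lambda>x. if 0 < v x then h x else 0) integrable_on {0..L}"
    and "(if 0 < v L then \<Phi> L else 0) - (if 0 < v 0 then \<Phi> 0 else 0)
      \<le> integral {0..L} (\<lambda>x. if 0 < v x then h x else 0)"
proof -
  let ?p = "\<lambda>x. if 0 < v x then h x else 0"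
  have cv: "continuous_on {0..L} v"
    using dv by (meson has_field_derivative_imp_has_derivative has_derivative_continuous_on)
  have left: "\<Phi> a \<le> 0" if "0 \<le> a" "a < c" "c \<le> L" "\<And>x. x \<in> {a<..<c} \<Longrightarrow> 0 < v x" "v a \<le> 0" for a c
    using zero_and_deriv_at_left_end[OF dv, of a c] up[of a] that by force
  have right: "0 \<le> \<Phi> a" if "0 \<le> c" "c < a" "a \<le> L" "\<And>x. x \<in> {c<..<a} \<Longrightarrow> 0 < v x" "v a \<le> 0" for a c
    using zero_and_deriv_at_right_end[OF dv, of a c] down[of a] that by force
  have ftc: "integral {a..b} h = \<Phi> b - \<Phi> a" if "0 \<le> a" "a \<le> b" "b \<le> L" for a b
    by (rule integral_unique, rule fundamental_theorem_of_calculus)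
      (use that in \<open>auto intro!: has_vector_derivative_within_subset[OF d\<Phi>[unfolded has_real_derivative_iff_has_vector_derivative]]\<close>)
  \<comment> \<open>Positivity is asked on the open interval only, so that \<open>a\<close> and
    \<open>b\<close> may be zeros of \<open>v\<close>; two points do not affect the
    integral.\<close>
  have pos: "integral {a..b} ?p = \<Phi> b - \<Phi> a"
    if "0 \<le> a" "a \<le> b" "b \<le> L" "\<And>x. x \<in> {a<..<b} \<Longrightarrow> 0 < v x" for a b
    using integral_spike[of "{a, b}" "{a..b}" h ?p] ftc[of a b] that by force
  have hL: "h absolutely_integrable_on {0..L}"
    using h by (intro absolutely_integrable_continuous_real)
  have meas: "{x \<in> {a<..<b}. 0 < v x} \<in> sets lebesgue" "open {x \<in> {a<..<b}. 0 < v x}"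
    if "0 \<le> a" "b \<le> L" for a b
  proof -
    have "continuous_on {a<..<b} v"
      by (rule continuous_on_subset[OF cv]) (use that in auto)
    then have "open ({a<..<b} \<inter> v -` {0<..})"
      by (rule continuous_open_preimage) auto
    then show "open {x \<in> {a<..<b}. 0 < v x}" by (simp add: Int_def vimage_def)
    then show "{x \<in> {a<..<b}. 0 < v x} \<in> sets lebesgue" by simp
  qed
  have sub: "h absolutely_integrable_on {x \<in> {a<..<b}. 0 < v x}"
    if "0 \<le> a" "b \<le> L" for a b
    by (rule set_integrable_subset[OF hL meas(1)[OF that]]) (use that in auto)
  have restr: "(?p has_integral integral {x \<in> {a<..<b}. 0 < v x} h) {a..b}" if "0 \<le> a" "b \<le> L" for a b
  proof -
    have "(h has_integral integral {x \<in> {a<..<b}. 0 < v x} h) {x \<in> {a<..<b}. 0 < v x}"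
      using set_lebesgue_integral_eq_integral(1)[OF sub[OF that]] by blast
    then have "((\<lambda>x. if x \<in> {x \<in> {a<..<b}. 0 < v x} then h x else 0) has_integral
        integral {x \<in> {a<..<b}. 0 < v x} h) {a..b}"
      by (subst has_integral_restrict) auto
    then show ?thesis
      by (rule has_integral_spike[of "{a, b}", rotated 2]) auto
  qed
  show int: "?p integrable_on {0..L}"
    using restr[of 0 L] by auto
  \<comment> \<open>Between two points where \<open>v\<close> is not positive, both ends of each
    component are zeros of \<open>v\<close>, so no boundary term survives.\<close>
  have mid: "0 \<le> integral {a..b} ?p" if ab: "0 \<le> a" "a \<le> b" "b \<le> L" "v a \<le> 0" "v b \<le> 0" for a b
  proof -
    let ?U = "{x \<in> {a<..<b}. 0 < v x}"
    have "0 \<le> integral ?U h"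
    proof (rule integral_open_nonneg)
      show "bounded ?U" by (rule bounded_subset[of "{a..b}"]) auto
      fix c d assume cd: "c < d" "{c<..<d} \<subseteq> ?U" "c \<notin> ?U" "d \<notin> ?U"
      have "{c<..<d} \<subseteq> {a..b}" using cd(2) by auto
      then have "{c..d} \<subseteq> {a..b}"
        using closure_mono[of "{c<..<d}" "{a..b}"] cd(1) by simp
      then have cd': "a \<le> c" "d \<le> b" using cd(1) by auto
      have "v c \<le> 0"
        using cd cd' ab by (cases "c = a") auto
      have "v d \<le> 0"
        using cd cd' ab by (cases "d = b") auto
      have pcd: "\<And>x. x \<in> {c<..<d} \<Longrightarrow> 0 < v x" using cd(2) by blast
      have "integral {c<..<d} h = \<Phi> d - \<Phi> c"
        using ftc[of c d] cd(1) cd' ab by (simp add: integral_open_interval_real)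
      moreover have "\<Phi> c \<le> 0" by (rule left[of c d]) (use pcd cd cd' ab \<open>v c \<le> 0\<close> in auto)
      moreover have "0 \<le> \<Phi> d" by (rule right[of c d]) (use pcd cd cd' ab \<open>v d \<le> 0\<close> in auto)
      ultimately show "0 \<le> integral {c<..<d} h" by simp
    qed (use meas sub ab in auto)
    then show ?thesis using restr[of a b] ab by (auto simp: integral_unique)
  qed
  show "(if 0 < v L then \<Phi> L else 0) - (if 0 < v 0 then \<Phi> 0 else 0) \<le> integral {0..L} ?p"
  proof (cases "\<forall>x\<in>{0..L}. 0 < v x")
    case True
    then show ?thesis using pos[of 0 L] \<open>0 < L\<close> by auto
  next
    case False
    \<comment> \<open>The edge is cut at the first and the last point where \<open>v\<close> is not
      positive. The two outer pieces lie in the positivity set up to their inner ends and carry the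
      boundary terms; the middle piece may contain infinitely many components and is handled by
      \<open>mid\<close>.\<close>
    define Z where "Z = {x \<in> {0..L}. v x \<le> 0}"
    have "closed Z"
      unfolding Z_def using continuous_closed_preimage[OF cv, of "{..0}"]
      by (simp add: vimage_def Int_def)
    moreover have Z: "Z \<noteq> {}" "bdd_below Z" "bdd_above Z"
      using False by (auto simp: Z_def not_less intro: bdd_belowI[of _ 0] bdd_aboveI[of _ L])
    ultimately have ends: "Inf Z \<in> Z" "Sup Z \<in> Z"
      by (auto intro: closed_contains_Inf closed_contains_Sup)
    define a b where "a = Inf Z" and "b = Sup Z"
    have ab: "0 \<le> a" "a \<le> b" "b \<le> L" "v a \<le> 0" "v b \<le> 0"
      using ends Z cInf_lower[of "Sup Z" Z] by (auto simp: a_def b_def Z_def)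
    have pa: "0 < v x" if "x \<in> {0..<a}" for x
      using that ab Z cInf_lower[of x Z] by (force simp: a_def Z_def)
    have pb: "0 < v x" if "x \<in> {b<..L}" for x
      using that ab Z cSup_upper[of x Z] by (force simp: b_def Z_def)
    have "integral {0..L} ?p = integral {0..a} ?p + integral {a..L} ?p"
      using int ab by (intro Henstock_Kurzweil_Integration.integral_combine[symmetric]) auto
    also have "integral {a..L} ?p = integral {a..b} ?p + integral {b..L} ?p"
      using ab by (intro Henstock_Kurzweil_Integration.integral_combine[symmetric] integrable_on_subinterval[OF int]) auto
    finally have eq: "integral {0..L} ?p = integral {0..a} ?p + (integral {a..b} ?p + integral {b..L} ?p)" .
    have 1: "- (if 0 < v 0 then \<Phi> 0 else 0) \<le> integral {0..a} ?p"
    proof (cases "a = 0")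
      case False
      then show ?thesis
        using pos[of 0 a] right[of 0 a] pa ab by force
    qed (use ab in auto)
    have 2: "(if 0 < v L then \<Phi> L else 0) \<le> integral {b..L} ?p"
    proof (cases "b = L")
      case False
      then show ?thesis
        using pos[of b L] left[of b L] pb ab by force
    qed (use ab in auto)
    show ?thesis using eq 1 2 mid[OF ab] by linarith
  qed
qed


section \<open>Backward difference quotients of the excess on one edge\<close>

text \<open>Looking backward from \<open>t\<close>, the positive part grows at most at the rate of
  \<open>V\<close> where \<open>V t x > 0\<close>, and not at all elsewhere. This one-sided bound
  avoids the kink of \<open>max 0\<close>; uniform continuity of \<open>Vt\<close> makes the error
  uniform in \<open>x\<close>.\<close>

lemma positive_part_decrease:
  fixes V Vt :: "real \<Rightarrow> real \<Rightarrow> real"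
  assumes "0 < L" "0 < t" "t \<le> T" "0 < e"
    and dV: "\<And>s x. s \<in> {0..T} \<Longrightarrow> x \<in> {0..L} \<Longrightarrow> ((\<lambda>s. V s x) has_real_derivative Vt s x) (at s within {0..T})"
    and cV: "continuous_on ({0..T} \<times> {0..L}) (\<lambda>(t, x). V t x)"
    and cVt: "continuous_on ({0..T} \<times> {0..L}) (\<lambda>(t, x). Vt t x)"
    and int: "(\<lambda>x. if 0 < V t x then Vt t x else 0) integrable_on {0..L}"
  shows "\<exists>s0. 0 \<le> s0 \<and> s0 < t \<and> (\<forall>s\<in>{s0<..<t}.
    integral {0..L} (\<lambda>x. max 0 (V t x)) - integral {0..L} (\<lambda>x. max 0 (V s x))
      \<le> (t - s) * (integral {0..L} (\<lambda>x. if 0 < V t x then Vt t x else 0) + e))"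
proof -
  let ?p = "\<lambda>x. if 0 < V t x then Vt t x else 0"
  have cx: "(\<lambda>x. max 0 (V s x)) integrable_on {0..L}" if "s \<in> {0..T}" for s
  proof -
    have "continuous_on {0..L} (\<lambda>x. (\<lambda>(t, x). V t x) (s, x))"
      by (rule continuous_on_compose2[OF cV]) (use that in \<open>auto intro!: continuous_intros\<close>)
    then show ?thesis
      by (auto intro!: integrable_continuous_real continuous_intros)
  qed
  have "uniformly_continuous_on ({0..T} \<times> {0..L}) (\<lambda>(t, x). Vt t x)"
    by (rule compact_uniformly_continuous[OF cVt]) (auto intro: compact_Times)
  \<comment> \<open>A pointwise error of \<open>e / L\<close> integrates to \<open>e\<close> over
    the edge.\<close>
  then obtain d where "0 < d" and d: "\<And>p q. p \<in> {0..T} \<times> {0..L} \<Longrightarrow> q \<in> {0..T} \<times> {0..L} \<Longrightarrow>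
      dist q p < d \<Longrightarrow> dist ((\<lambda>(t, x). Vt t x) q) ((\<lambda>(t, x). Vt t x) p) < e / L"
    unfolding uniformly_continuous_on_def using divide_pos_pos[OF \<open>0 < e\<close> \<open>0 < L\<close>] by meson
  show ?thesis
  proof (intro exI[of _ "max 0 (t - d)"] conjI ballI)
    fix s assume s: "s \<in> {max 0 (t - d)<..<t}"
    \<comment> \<open>for the later time \<open>t\<close>, \<open>max 0 a - max 0 b \<le> (if 0 < a then a - b else 0)\<close>\<close>
    have pt: "max 0 (V t x) - max 0 (V s x) \<le> (t - s) * (?p x + e / L)" if x: "x \<in> {0..L}" for x
    proof -
      have "\<exists>z\<in>{s<..<t}. V t x - V s x = Vt z x * (t - s)"
      proof (rule mvt_simple)
        fix z assume z: "s \<le> z" "z \<le> t"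
        have "((\<lambda>s. V s x) has_real_derivative Vt z x) (at z within {0..T})"
          by (rule dV) (use z s x \<open>t \<le> T\<close> in auto)
        then have "((\<lambda>s. V s x) has_real_derivative Vt z x) (at z within {s..t})"
          by (rule has_field_derivative_subset) (use s \<open>t \<le> T\<close> in auto)
        then show "((\<lambda>s. V s x) has_derivative (*) (Vt z x)) (at z within {s..t})"
          by (simp add: has_field_derivative_def)
      qed (use s in auto)
      then obtain z where z: "z \<in> {s<..<t}" "V t x - V s x = (t - s) * Vt z x"
        by (auto simp: mult.commute)
      have "\<bar>Vt z x - Vt t x\<bar> < e / L"
        using d[of "(t, x)" "(z, x)"] z s x \<open>t \<le> T\<close> by (auto simp: dist_Pair_Pair dist_real_def)
      then have "(t - s) * Vt z x \<le> (t - s) * (Vt t x + e / L)"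
        using s by (intro mult_left_mono) auto
      \<comment> \<open>This settles the points with \<open>V t x \<le> 0\<close>, where the
        left-hand side is at most 0 and \<open>?p x\<close> is 0.\<close>
      moreover have "0 \<le> (t - s) * (e / L)"
        using s \<open>0 < e\<close> \<open>0 < L\<close> by simp
      ultimately show ?thesis
        using z(2) by (auto simp: max_def)
    qed
    have "integral {0..L} (\<lambda>x. max 0 (V t x)) - integral {0..L} (\<lambda>x. max 0 (V s x))
        = integral {0..L} (\<lambda>x. max 0 (V t x) - max 0 (V s x))"
      using cx s \<open>t \<le> T\<close> by (intro Henstock_Kurzweil_Integration.integral_diff[symmetric]) auto
    also have "\<dots> \<le> integral {0..L} (\<lambda>x. (t - s) * (?p x + e / L))"
      using cx[of s] cx[of t] s \<open>t \<le> T\<close> pt int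
      by (intro integral_le integrable_diff integrable_on_mult_right integrable_add) auto
    also have "\<dots> = (t - s) * (integral {0..L} ?p + e)"
      using int \<open>0 < L\<close>
      by (subst integral_mult_right, subst Henstock_Kurzweil_Integration.integral_add) auto
    finally show "integral {0..L} (\<lambda>x. max 0 (V t x)) - integral {0..L} (\<lambda>x. max 0 (V s x))
      \<le> (t - s) * (integral {0..L} ?p + e)" .
  qed (use \<open>0 < t\<close> \<open>0 < d\<close> in auto)
qed

section \<open>Regularity, compatibility functions and sums over the graph\<close>

lemma Ck_on_imp_continuous_on: "Ck_on k S g \<Longrightarrow> continuous_on S g"
  by (cases k) (auto intro: has_derivative_continuous_on)

text \<open>The edge equations yield time derivatives only point by point. Their joint continuity,
  needed for the uniform estimate on an edge, comes from the gradient, paired with the time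
  direction \<open>(1, 0)\<close>.\<close>

lemma Ck_on_1_time_derivative:
  fixes g :: "real \<Rightarrow> real \<Rightarrow> real"
  assumes "Ck_on 1 (A \<times> B) (\<lambda>(t, x). g t x)"
  obtains gt where "continuous_on (A \<times> B) (\<lambda>(t, x). gt t x)"
    "\<And>t x. t \<in> A \<Longrightarrow> x \<in> B \<Longrightarrow> ((\<lambda>s. g s x) has_real_derivative gt t x) (at t within A)"
proof -
  obtain D where D: "\<And>p. p \<in> A \<times> B \<Longrightarrow> ((\<lambda>(t, x). g t x) has_derivative (\<lambda>h. D p \<bullet> h)) (at p within A \<times> B)"
    and cD: "\<And>b. b \<in> Basis \<Longrightarrow> continuous_on (A \<times> B) (\<lambda>p. D p \<bullet> b)"
    using assms unfolding One_nat_def Ck_on.simps by blast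
  show thesis
  proof (rule that[of "\<lambda>t x. D (t, x) \<bullet> (1, 0)"])
    have "(1::real, 0::real) \<in> Basis" by (simp add: Basis_prod_def)
    from cD[OF this] show "continuous_on (A \<times> B) (\<lambda>(t, x). D (t, x) \<bullet> (1, 0))"
      by (simp add: case_prod_unfold)
    fix t x assume tx: "t \<in> A" "x \<in> B"
    have "((\<lambda>s. (\<lambda>(t, x). g t x) (s, x)) has_derivative (\<lambda>h. D (t, x) \<bullet> (h, 0))) (at t within A)"
      by (rule has_derivative_in_compose2[where t = "A \<times> B" and f = "\<lambda>s. (s, x)" and f' = "\<lambda>h. (h, 0)" and g' = "\<lambda>p h. D p \<bullet> h"])
        (use D tx in \<open>auto intro!: derivative_eq_intros\<close>)
    moreover have "(\<lambda>h. D (t, x) \<bullet> (h, 0)) = (*) (D (t, x) \<bullet> (1, 0))"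
      by (cases "D (t, x)") auto
    ultimately show "((\<lambda>s. g s x) has_real_derivative D (t, x) \<bullet> (1, 0)) (at t within A)"
      unfolding has_field_derivative_def by simp
  qed
qed

text \<open>Nodal densities may vanish, while the compatibility functions are given as strictly
  increasing only at positive densities. The limit at 0 yields a weak inequality; the intermediate
  point \<open>y / 2\<close> restores strictness.\<close>

lemma strict_mono_on_closure_half_line:
  fixes f :: "real \<Rightarrow> real"
  assumes f: "continuous_on {0..} f" "strict_mono_on {0<..} f"
  shows "strict_mono_on {0..} f"
proof (rule strict_mono_onI)
  fix x y :: real assume xy: "x \<in> {0..}" "y \<in> {0..}" "x < y"
  show "f x < f y"
  proof (cases "x = 0")
    case True
    have "(f \<longlongrightarrow> f 0) (at 0 within {0..})"
      using f(1) by (simp add: continuous_on_def)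
    then have "(f \<longlongrightarrow> f 0) (at_right 0)"
      by (rule tendsto_mono[rotated]) (auto intro: at_le)
    moreover have "\<forall>\<^sub>F z in at_right 0. f z \<le> f (y / 2)"
      unfolding eventually_at_right_field
      using xy True strict_mono_onD[OF f(2)] by (intro exI[of _ "y / 2"]) (auto intro: less_imp_le)
    ultimately have "f 0 \<le> f (y / 2)"
      by (rule tendsto_upperbound) simp
    also have "\<dots> < f y"
      using xy True by (intro strict_mono_onD[OF f(2)]) auto
    finally show ?thesis using True by simp
  qed (use xy strict_mono_onD[OF f(2), of x y] in auto)
qed

lemma ivp_solution_edgeE:
  assumes "ivp_solution G \<epsilon> q \<rho>0 \<phi>0 \<rho> \<phi> r"
    and "e \<in> edges G" "t \<in> {0..horizon G}" "x \<in> {0..len G e}"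
  obtains \<rho>t \<rho>x \<phi>x where "((\<lambda>s. \<rho> e s x) has_real_derivative \<rho>t) (at t within {0..horizon G})"
    "((\<lambda>y. \<rho> e t y) has_real_derivative \<rho>x) (at x within {0..len G e})"
    "((\<lambda>y. \<phi> e t y) has_real_derivative \<phi>x) (at x within {0..len G e})"
    "\<rho>t + \<phi>x - \<epsilon> = 0" "\<phi> e t x + dissip G e t (\<rho> e t x) \<rho>x = 0"
proof -
  have "edge_equations G \<epsilon> \<rho> \<phi>"
    using assms(1) by (simp add: ivp_solution_def)
  from this[unfolded edge_equations_def, rule_format, OF assms(2-4)] show thesis
    using that by blast
qed

text \<open>Grouping by first vertex suits the fluxes at \<open>x = 0\<close>, grouping by second
  vertex those at \<open>x = L\<close>; both then meet in the nodal condition of one vertex.\<close>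

lemma sum_edges_by_vertex:
  fixes f :: "'v \<times> 'v \<Rightarrow> real"
  assumes "finite V" "E \<subseteq> V \<times> V"
  shows "(\<Sum>e\<in>E. f e) = (\<Sum>j\<in>V. \<Sum>k | (j, k) \<in> E. f (j, k))"
    and "(\<Sum>e\<in>E. f e) = (\<Sum>j\<in>V. \<Sum>i | (i, j) \<in> E. f (i, j))"
proof -
  have fin: "finite {k. (j, k) \<in> E}" "finite {k. (k, j) \<in> E}" for j
    by (rule finite_subset[OF _ assms(1)]; use assms(2) in auto)+
  have "(\<Sum>j\<in>V. \<Sum>k | (j, k) \<in> E. f (j, k)) = (\<Sum>(j, k)\<in>Sigma V (\<lambda>j. {k. (j, k) \<in> E}). f (j, k))"
    using assms(1) fin by (intro sum.Sigma) auto
  also have "Sigma V (\<lambda>j. {k. (j, k) \<in> E}) = E" using assms(2) by auto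
  finally show "(\<Sum>e\<in>E. f e) = (\<Sum>j\<in>V. \<Sum>k | (j, k) \<in> E. f (j, k))" by simp
  have "(\<Sum>j\<in>V. \<Sum>i | (i, j) \<in> E. f (i, j)) = (\<Sum>(j, i)\<in>Sigma V (\<lambda>j. {i. (i, j) \<in> E}). f (i, j))"
    using assms(1) fin by (intro sum.Sigma) auto
  also have "\<dots> = (\<Sum>e\<in>E. f e)"
    by (rule sum.reindex_bij_witness[of _ prod.swap prod.swap]) (use assms(2) in auto)
  finally show "(\<Sum>e\<in>E. f e) = (\<Sum>j\<in>V. \<Sum>i | (i, j) \<in> E. f (i, j))" by simp
qed

section \<open>The comparison theorem\<close>

theorem theorem1:
  fixes G :: "'v network"
    and q1 q2 :: "'v \<Rightarrow> real \<Rightarrow> real"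
    and \<rho>01 \<phi>01 \<rho>02 \<phi>02 :: "'v \<times> 'v \<Rightarrow> real \<Rightarrow> real"
    and \<rho>1 \<phi>1 \<rho>2 \<phi>2 :: "'v \<times> 'v \<Rightarrow> real \<Rightarrow> real \<Rightarrow> real"
    and r1 r2 :: "'v \<Rightarrow> real \<Rightarrow> real"
    and S :: "'v set"
    and t0 :: real
  assumes "flow_network G"
    and "\<forall>e\<in>edges G. \<forall>t\<in>{0..horizon G}. \<forall>u\<ge>0. strict_mono (dissip G e t u)"
    and "assumption_A G q1 \<rho>01 \<phi>01"
    and "assumption_A G q2 \<rho>02 \<phi>02"
    and "classical_solution G q1 \<rho>01 \<phi>01 \<rho>1 \<phi>1 r1"
    and "classical_solution G q2 \<rho>02 \<phi>02 \<rho>2 \<phi>2 r2"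
    and "\<forall>e\<in>edges G. \<forall>x\<in>{0..len G e}. \<rho>1 e 0 x \<ge> \<rho>2 e 0 x"
    and "S \<subseteq> verts G"
    and "t0 \<in> {0..horizon G}"
    and "\<forall>i\<in>S. \<forall>t\<in>{0..t0}. q1 i t \<ge> q2 i t"
    and "\<forall>i\<in>verts G - S. \<forall>t\<in>{0..t0}. r1 i t \<ge> r2 i t"
  shows "\<forall>e\<in>edges G. \<forall>x\<in>{0..len G e}. \<forall>t\<in>{0..t0}. \<rho>1 e t x \<ge> \<rho>2 e t x"
proof -
  let ?T = "horizon G" and ?E = "edges G" and ?l = "len G"
  define V where "V = (\<lambda>e t x. \<rho>2 e t x - \<rho>1 e t x)"
  define \<Phi> where "\<Phi> = (\<lambda>e t x. \<phi>2 e t x - \<phi>1 e t x)"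
  have net: "finite (verts G)" "?E \<subseteq> verts G \<times> verts G" "\<And>e. e \<in> ?E \<Longrightarrow> 0 < ?l e" "0 < ?T"
    and mono0: "\<And>e t. e \<in> ?E \<Longrightarrow> t \<in> {0..?T} \<Longrightarrow>
      strict_mono_on {0<..} (compat_lo G e t) \<and> strict_mono_on {0<..} (compat_hi G e t)"
    using assms(1) by (auto simp: flow_network_def)
  have finE: "finite ?E"
    using net(1,2) finite_subset by blast
  have t0: "0 \<le> t0" "t0 \<le> ?T" using assms(9) by auto
  have sol1: "ivp_solution G 0 q1 \<rho>01 \<phi>01 \<rho>1 \<phi>1 r1" "regular G 1 \<rho>1 \<phi>1"
    and sol2: "ivp_solution G 0 q2 \<rho>02 \<phi>02 \<rho>2 \<phi>2 r2" "regular G 1 \<rho>2 \<phi>2"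
    using assms(5,6) by (auto simp: classical_solution_def)
  have nonneg: "0 \<le> \<rho>1 e t x" "0 \<le> \<rho>2 e t x" if "e \<in> ?E" "t \<in> {0..?T}" "x \<in> {0..?l e}" for e t x
    using sol1(1) sol2(1) that by (auto simp: ivp_solution_def)
  have rnonneg: "0 \<le> r1 i t" "0 \<le> r2 i t" if "i \<in> verts G" "t \<in> {0..?T}" for i t
    using sol1(1) sol2(1) that by (auto simp: ivp_solution_def)
  have nodal: "nodal_conditions G t (\<lambda>i. q1 i t) (\<lambda>e. \<rho>1 e t) (\<lambda>e. \<phi>1 e t) (\<lambda>i. r1 i t)"
      "nodal_conditions G t (\<lambda>i. q2 i t) (\<lambda>e. \<rho>2 e t) (\<lambda>e. \<phi>2 e t) (\<lambda>i. r2 i t)"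
    if "t \<in> {0..?T}" for t
    using sol1(1) sol2(1) that by (auto simp: ivp_solution_def)
  have mono: "strict_mono_on {0..} (compat_lo G e t)" "strict_mono_on {0..} (compat_hi G e t)"
    if e: "e \<in> ?E" and t: "t \<in> {0..?T}" for e t
  proof -
    obtain k where "parameters_ok G k q1"
      using assms(3) by (auto simp: assumption_A_def)
    then have lo: "continuous_on ({0..?T} \<times> {0..}) (\<lambda>(t, u). compat_lo G e t u)"
      and hi: "continuous_on ({0..?T} \<times> {0..}) (\<lambda>(t, u). compat_hi G e t u)"
      using e by (auto simp: parameters_ok_def intro: Ck_on_imp_continuous_on)
    have "continuous_on {0..} (\<lambda>u. (\<lambda>(t, u). compat_lo G e t u) (t, u))"
      by (rule continuous_on_compose2[OF lo]) (use t in \<open>auto intro!: continuous_intros\<close>)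
    moreover have "continuous_on {0..} (\<lambda>u. (\<lambda>(t, u). compat_hi G e t u) (t, u))"
      by (rule continuous_on_compose2[OF hi]) (use t in \<open>auto intro!: continuous_intros\<close>)
    ultimately show "strict_mono_on {0..} (compat_lo G e t)" "strict_mono_on {0..} (compat_hi G e t)"
      using mono0[OF e t] by (auto intro: strict_mono_on_closure_half_line)
  qed
  \<comment> \<open>Positivity of \<open>V\<close> at an edge end depends on the vertex alone, so
    the fluxes at a vertex are counted either all together or not at all.\<close>
  have V_ends: "0 < V (i, j) t 0 \<longleftrightarrow> r1 i t < r2 i t" "0 < V (i, j) t (?l (i, j)) \<longleftrightarrow> r1 j t < r2 j t"
    if e: "(i, j) \<in> ?E" and t: "t \<in> {0..?T}" for i j t
  proof -
    have "\<rho>1 (i, j) t 0 = compat_lo G (i, j) t (r1 i t)" "\<rho>1 (i, j) t (?l (i, j)) = compat_hi G (i, j) t (r1 j t)"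
      "\<rho>2 (i, j) t 0 = compat_lo G (i, j) t (r2 i t)" "\<rho>2 (i, j) t (?l (i, j)) = compat_hi G (i, j) t (r2 j t)"
      using nodal[OF t] e unfolding nodal_conditions_def by blast+
    moreover have "i \<in> verts G" "j \<in> verts G" using e net(2) by auto
    ultimately show "0 < V (i, j) t 0 \<longleftrightarrow> r1 i t < r2 i t" "0 < V (i, j) t (?l (i, j)) \<longleftrightarrow> r1 j t < r2 j t"
      using strict_mono_on_less[OF mono(1)[OF e t]] strict_mono_on_less[OF mono(2)[OF e t]] rnonneg[OF _ t]
      by (simp_all add: V_def)
  qed
  have "\<exists>Vt. continuous_on ({0..?T} \<times> {0..?l e}) (\<lambda>(t, x). Vt t x) \<and>
      (\<forall>t\<in>{0..?T}. \<forall>x\<in>{0..?l e}. ((\<lambda>s. V e s x) has_real_derivative Vt t x) (at t within {0..?T}))"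
    if e: "e \<in> ?E" for e
  proof -
    have 1: "Ck_on 1 ({0..?T} \<times> {0..?l e}) (\<lambda>(t, x). \<rho>1 e t x)"
      and 2: "Ck_on 1 ({0..?T} \<times> {0..?l e}) (\<lambda>(t, x). \<rho>2 e t x)"
      using sol1(2) sol2(2) e unfolding regular_def by blast+
    obtain g1 where g1: "continuous_on ({0..?T} \<times> {0..?l e}) (\<lambda>(t, x). g1 t x)"
      "\<And>t x. t \<in> {0..?T} \<Longrightarrow> x \<in> {0..?l e} \<Longrightarrow>
        ((\<lambda>s. \<rho>1 e s x) has_real_derivative g1 t x) (at t within {0..?T})"
      using Ck_on_1_time_derivative[OF 1] by metis
    obtain g2 where g2: "continuous_on ({0..?T} \<times> {0..?l e}) (\<lambda>(t, x). g2 t x)"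
      "\<And>t x. t \<in> {0..?T} \<Longrightarrow> x \<in> {0..?l e} \<Longrightarrow>
        ((\<lambda>s. \<rho>2 e s x) has_real_derivative g2 t x) (at t within {0..?T})"
      using Ck_on_1_time_derivative[OF 2] by metis
    show ?thesis
      by (rule exI[of _ "\<lambda>t x. g2 t x - g1 t x"])
        (use continuous_on_diff[OF g2(1) g1(1)] g1(2) g2(2) in
          \<open>auto simp: V_def case_prod_unfold intro!: DERIV_diff\<close>)
  qed
  then obtain Vt where Vt_cont: "\<And>e. e \<in> ?E \<Longrightarrow> continuous_on ({0..?T} \<times> {0..?l e}) (\<lambda>(t, x). Vt e t x)"
    and Vt: "\<And>e t x. e \<in> ?E \<Longrightarrow> t \<in> {0..?T} \<Longrightarrow> x \<in> {0..?l e} \<Longrightarrow>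
      ((\<lambda>s. V e s x) has_real_derivative Vt e t x) (at t within {0..?T})"
    by metis
  have V_cont: "continuous_on ({0..?T} \<times> {0..?l e}) (\<lambda>(t, x). V e t x)" if "e \<in> ?E" for e
  proof -
    have "continuous_on ({0..?T} \<times> {0..?l e}) (\<lambda>(t, x). \<rho>1 e t x)"
      "continuous_on ({0..?T} \<times> {0..?l e}) (\<lambda>(t, x). \<rho>2 e t x)"
      using sol1(2) sol2(2) that unfolding regular_def by (blast intro: Ck_on_imp_continuous_on)+
    from continuous_on_diff[OF this(2,1)] show ?thesis
      by (simp add: V_def case_prod_unfold)
  qed

  \<comment> \<open>Where \<open>V\<close> vanishes, both dissipation terms have the same first two
    arguments, so monotonicity in the gradient makes \<open>\<Phi>\<close> weakly opposite in sign
    to \<open>Vx\<close>.\<close>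
  have space: "\<exists>Vx. ((V e t) has_real_derivative Vx) (at x within {0..?l e}) \<and>
      ((\<Phi> e t) has_real_derivative - Vt e t x) (at x within {0..?l e}) \<and>
      (V e t x = 0 \<longrightarrow> (0 \<le> Vx \<longrightarrow> \<Phi> e t x \<le> 0) \<and> (Vx \<le> 0 \<longrightarrow> 0 \<le> \<Phi> e t x))"
    if e: "e \<in> ?E" and t: "t \<in> {0..?T}" and x: "x \<in> {0..?l e}" for e t x
  proof -
    obtain a1 b1 c1 where 1: "((\<lambda>s. \<rho>1 e s x) has_real_derivative a1) (at t within {0..?T})"
      "((\<lambda>y. \<rho>1 e t y) has_real_derivative b1) (at x within {0..?l e})"
      "((\<lambda>y. \<phi>1 e t y) has_real_derivative c1) (at x within {0..?l e})"
      "a1 + c1 - 0 = 0" "\<phi>1 e t x + dissip G e t (\<rho>1 e t x) b1 = 0"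
      by (rule ivp_solution_edgeE[OF sol1(1) e t x])
    obtain a2 b2 c2 where 2: "((\<lambda>s. \<rho>2 e s x) has_real_derivative a2) (at t within {0..?T})"
      "((\<lambda>y. \<rho>2 e t y) has_real_derivative b2) (at x within {0..?l e})"
      "((\<lambda>y. \<phi>2 e t y) has_real_derivative c2) (at x within {0..?l e})"
      "a2 + c2 - 0 = 0" "\<phi>2 e t x + dissip G e t (\<rho>2 e t x) b2 = 0"
      by (rule ivp_solution_edgeE[OF sol2(1) e t x])
    have "((\<lambda>s. V e s x) has_real_derivative a2 - a1) (at t within {0..?T})"
      using DERIV_diff[OF 2(1) 1(1)] by (simp add: V_def)
    \<comment> \<open>\<open>Vt\<close> stems from the regularity and \<open>a2 - a1\<close> from
      the edge equations; uniqueness of derivatives within an interval of positive length identifies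
      them.\<close>
    with Vt[OF e t x] have "((\<lambda>s. V e s x) has_vector_derivative Vt e t x) (at t within cbox 0 ?T)"
      "((\<lambda>s. V e s x) has_vector_derivative a2 - a1) (at t within cbox 0 ?T)"
      by (simp_all add: has_real_derivative_iff_has_vector_derivative)
    then have "Vt e t x = a2 - a1"
      by (rule vector_derivative_unique_within_closed_interval[rotated 2]) (use net(4) t in auto)
    then have c: "- Vt e t x = c2 - c1" using 1(4) 2(4) by simp
    have m: "strict_mono (dissip G e t (\<rho>1 e t x))"
      using assms(2) e t nonneg(1)[OF e t x] by blast
    show ?thesis
    proof (intro exI[of _ "b2 - b1"] conjI impI)
      show "((V e t) has_real_derivative b2 - b1) (at x within {0..?l e})"
        using DERIV_diff[OF 2(2) 1(2)] by (simp add: V_def)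
      show "((\<Phi> e t) has_real_derivative - Vt e t x) (at x within {0..?l e})"
        using DERIV_diff[OF 2(3) 1(3)] c by (simp add: \<Phi>_def)
      assume "V e t x = 0"
      then have eq: "\<rho>2 e t x = \<rho>1 e t x" by (simp add: V_def)
      show "\<Phi> e t x \<le> 0" if "0 \<le> b2 - b1"
        using strict_mono_less_eq[OF m, of b1 b2] that 1(5) 2(5) eq by (simp add: \<Phi>_def)
      show "0 \<le> \<Phi> e t x" if "b2 - b1 \<le> 0"
        using strict_mono_less_eq[OF m, of b2 b1] that 1(5) 2(5) eq by (simp add: \<Phi>_def)
    qed
  qed

  \<comment> \<open>The space derivative of \<open>\<Phi>\<close> is \<open>- Vt\<close>, so the
    lower bound for its integral turns into an upper bound for that of \<open>Vt\<close>.\<close>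
  have flux: "(\<lambda>x. if 0 < V e t x then Vt e t x else 0) integrable_on {0..?l e}"
    "integral {0..?l e} (\<lambda>x. if 0 < V e t x then Vt e t x else 0)
      \<le> (if 0 < V e t 0 then \<Phi> e t 0 else 0) - (if 0 < V e t (?l e) then \<Phi> e t (?l e) else 0)"
    if e: "e \<in> ?E" and t: "t \<in> {0..?T}" for e t
  proof -
    obtain Vx where Vx: "\<And>x. x \<in> {0..?l e} \<Longrightarrow> ((V e t) has_real_derivative Vx x) (at x within {0..?l e}) \<and>
      ((\<Phi> e t) has_real_derivative - Vt e t x) (at x within {0..?l e}) \<and>
      (V e t x = 0 \<longrightarrow> (0 \<le> Vx x \<longrightarrow> \<Phi> e t x \<le> 0) \<and> (Vx x \<le> 0 \<longrightarrow> 0 \<le> \<Phi> e t x))"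
      using space[OF e t] by metis
    have "continuous_on {0..?l e} (\<lambda>x. (\<lambda>(t, x). Vt e t x) (t, x))"
      by (rule continuous_on_compose2[OF Vt_cont[OF e]]) (use t in \<open>auto intro!: continuous_intros\<close>)
    then have h: "continuous_on {0..?l e} (\<lambda>x. - Vt e t x)"
      by (auto intro: continuous_on_minus)
    note pf = positive_part_flux[OF net(3)[OF e], of "V e t" Vx "\<Phi> e t" "\<lambda>x. - Vt e t x"]
    have neg: "(\<lambda>x. if 0 < V e t x then - Vt e t x else 0) = (\<lambda>x. - (if 0 < V e t x then Vt e t x else 0))"
      by auto
    have i: "(\<lambda>x. - (if 0 < V e t x then Vt e t x else 0)) integrable_on {0..?l e}"
      unfolding neg[symmetric] by (rule pf(1)) (use Vx h in auto)
    then show "(\<lambda>x. if 0 < V e t x then Vt e t x else 0) integrable_on {0..?l e}"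
      by (simp only: integrable_neg_iff)
    have "(if 0 < V e t (?l e) then \<Phi> e t (?l e) else 0) - (if 0 < V e t 0 then \<Phi> e t 0 else 0)
      \<le> integral {0..?l e} (\<lambda>x. if 0 < V e t x then - Vt e t x else 0)"
      by (rule pf(2)) (use Vx h in auto)
    then show "integral {0..?l e} (\<lambda>x. if 0 < V e t x then Vt e t x else 0)
      \<le> (if 0 < V e t 0 then \<Phi> e t 0 else 0) - (if 0 < V e t (?l e) then \<Phi> e t (?l e) else 0)"
      unfolding neg integral_neg by simp
  qed

  have balance: "(\<Sum>e\<in>?E. (if 0 < V e t 0 then \<Phi> e t 0 else 0) - (if 0 < V e t (?l e) then \<Phi> e t (?l e) else 0)) \<le> 0"
    if t: "t \<in> {0..t0}" for t
  proof -
    have tT: "t \<in> {0..?T}" using t t0 by auto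
    let ?out = "\<lambda>j. \<Sum>k | (j, k) \<in> ?E. \<Phi> (j, k) t 0" and ?in = "\<lambda>j. \<Sum>i | (i, j) \<in> ?E. \<Phi> (i, j) t (?l (i, j))"
    have "(\<Sum>e\<in>?E. if 0 < V e t 0 then \<Phi> e t 0 else 0) = (\<Sum>j\<in>verts G. if r1 j t < r2 j t then ?out j else 0)"
      unfolding sum_edges_by_vertex(1)[OF net(1,2)] by (intro sum.cong) (auto simp: V_ends[OF _ tT])
    moreover have "(\<Sum>e\<in>?E. if 0 < V e t (?l e) then \<Phi> e t (?l e) else 0) = (\<Sum>j\<in>verts G. if r1 j t < r2 j t then ?in j else 0)"
      unfolding sum_edges_by_vertex(2)[OF net(1,2)] by (intro sum.cong) (auto simp: V_ends[OF _ tT])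
    moreover have "(if r1 j t < r2 j t then ?out j else 0) \<le> (if r1 j t < r2 j t then ?in j else 0)"
      if j: "j \<in> verts G" for j
    proof (cases "r1 j t < r2 j t")
      case True
      \<comment> \<open>Outside \<open>S\<close> the nodal densities are ordered the other way;
        inside \<open>S\<close> the injections are ordered, and they equal the net outflow by the
        nodal conditions.\<close>
      then have "j \<in> S" using assms(11) j t by force
      then have "q2 j t \<le> q1 j t" using assms(10) t by blast
      moreover have
        "q1 j t + (\<Sum>i | (i, j) \<in> ?E. \<phi>1 (i, j) t (?l (i, j))) - (\<Sum>k | (j, k) \<in> ?E. \<phi>1 (j, k) t 0) = 0"
        "q2 j t + (\<Sum>i | (i, j) \<in> ?E. \<phi>2 (i, j) t (?l (i, j))) - (\<Sum>k | (j, k) \<in> ?E. \<phi>2 (j, k) t 0) = 0"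
        using nodal[OF tT] j unfolding nodal_conditions_def by blast+
      then have "?out j - ?in j = q2 j t - q1 j t"
        by (simp add: \<Phi>_def sum_subtractf)
      ultimately show ?thesis by simp
    qed auto
    ultimately show ?thesis
      by (simp add: sum_subtractf sum_mono)
  qed

  \<comment> \<open>Decrease of the total excess and conclusion\<close>
  define M where "M = (\<lambda>t. \<Sum>e\<in>?E. integral {0..?l e} (\<lambda>x. max 0 (V e t x)))"
  have M_cont: "continuous_on {0..?T} M"
    unfolding M_def
  proof (intro continuous_on_sum)
    fix e assume e: "e \<in> ?E"
    have "continuous_on ({0..?T} \<times> cbox 0 (?l e)) (\<lambda>(t, x). max 0 (V e t x))"
      using continuous_on_max[OF continuous_on_const V_cont[OF e], of 0] by (simp add: case_prod_unfold)
    then show "continuous_on {0..?T} (\<lambda>t. integral {0..?l e} (\<lambda>x. max 0 (V e t x)))"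
      using integral_continuous_on_param by fastforce
  qed
  have M_le: "M \<tau> \<le> M 0" if \<tau>: "\<tau> \<in> {0..t0}" for \<tau>
  proof (rule left_nonincreasing_imp_le[of 0 \<tau> M])
    show "continuous_on {0..\<tau>} M" by (rule continuous_on_subset[OF M_cont]) (use \<tau> t0 in auto)
    show "0 \<le> \<tau>" using \<tau> by simp
    fix t \<epsilon> :: real assume t: "t \<in> {0<..\<tau>}" and "0 < \<epsilon>"
    \<comment> \<open>The tolerance is shared among the edges; the added 1 keeps \<open>n\<close>
      positive if there are none.\<close>
    define n where "n = real (card ?E) + 1"
    have n: "0 < n" "real (card ?E) * (\<epsilon> / n) \<le> \<epsilon>"
      using \<open>0 < \<epsilon>\<close> by (auto simp: n_def field_simps)
    have tT: "t \<in> {0..?T}" "t \<in> {0..t0}" using t \<tau> t0 by auto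
    let ?I = "\<lambda>e t. integral {0..?l e} (\<lambda>x. max 0 (V e t x))"
    let ?J = "\<lambda>e. integral {0..?l e} (\<lambda>x. if 0 < V e t x then Vt e t x else 0)"
    have "\<forall>e\<in>?E. \<exists>s0. 0 \<le> s0 \<and> s0 < t \<and> (\<forall>s\<in>{s0<..<t}. ?I e t - ?I e s \<le> (t - s) * (?J e + \<epsilon> / n))"
    proof
      fix e assume e: "e \<in> ?E"
      show "\<exists>s0. 0 \<le> s0 \<and> s0 < t \<and> (\<forall>s\<in>{s0<..<t}. ?I e t - ?I e s \<le> (t - s) * (?J e + \<epsilon> / n))"
        using positive_part_decrease[OF net(3)[OF e] _ _ _ Vt[OF e] V_cont[OF e] Vt_cont[OF e]
            flux(1)[OF e tT(1)], of "\<epsilon> / n"]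
          t tT(1) \<open>0 < \<epsilon>\<close> n(1)
        by simp
    qed
    from bchoice[OF this] obtain s0 where s0: "\<forall>e\<in>?E. 0 \<le> s0 e \<and> s0 e < t \<and>
        (\<forall>s\<in>{s0 e<..<t}. ?I e t - ?I e s \<le> (t - s) * (?J e + \<epsilon> / n))"
      by blast
    have "(\<Sum>e\<in>?E. ?J e) \<le> 0"
      using sum_mono[of ?E ?J, OF flux(2)[OF _ tT(1)]] balance[OF tT(2)] by linarith
    moreover have "(\<Sum>e\<in>?E. \<epsilon> / n) \<le> \<epsilon>" using n(2) by simp
    ultimately have J: "(\<Sum>e\<in>?E. ?J e + \<epsilon> / n) \<le> \<epsilon>" by (simp only: sum.distrib)
    show "\<exists>s0. 0 \<le> s0 \<and> s0 < t \<and> (\<forall>s\<in>{s0<..<t}. M t - M s \<le> \<epsilon> * (t - s))"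
    \<comment> \<open>The latest of the finitely many starting times serves all edges; inserting 0
      keeps the maximum defined on an empty edge set.\<close>
    proof (intro exI[of _ "Max (insert 0 (s0 ` ?E))"] conjI ballI)
      show "0 \<le> Max (insert 0 (s0 ` ?E))" using finE by simp
      show "Max (insert 0 (s0 ` ?E)) < t" using finE s0 t by (subst Max_less_iff) auto
      fix s assume s: "s \<in> {Max (insert 0 (s0 ` ?E))<..<t}"
      have "M t - M s = (\<Sum>e\<in>?E. ?I e t - ?I e s)" by (simp add: M_def sum_subtractf)
      also have "\<dots> \<le> (\<Sum>e\<in>?E. (t - s) * (?J e + \<epsilon> / n))"
        using s s0 finE by (intro sum_mono) auto
      also have "\<dots> = (t - s) * (\<Sum>e\<in>?E. ?J e + \<epsilon> / n)" by (simp add: sum_distrib_left)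
      also have "\<dots> \<le> (t - s) * \<epsilon>" using J s by (intro mult_left_mono) auto
      finally show "M t - M s \<le> \<epsilon> * (t - s)" by (simp add: mult.commute)
    qed
  qed
  have "V e 0 x \<le> 0" if "e \<in> ?E" "x \<in> {0..?l e}" for e x
    using assms(7) that by (auto simp: V_def)
  then have "integral {0..?l e} (\<lambda>x. max 0 (V e 0 x)) = 0" if "e \<in> ?E" for e
    using that integral_cong[of "{0..?l e}" "\<lambda>x. max 0 (V e 0 x)" "\<lambda>x. 0"] by (simp add: max_absorb1)
  then have "M 0 = 0" by (simp add: M_def)
  show ?thesis
  proof (intro ballI)
    fix e x t assume e: "e \<in> ?E" and x: "x \<in> {0..?l e}" and t: "t \<in> {0..t0}"
    have c: "continuous_on {0..?l e} (\<lambda>x. max 0 (V e t x))" if "e \<in> ?E" for e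
    proof -
      have "continuous_on {0..?l e} (\<lambda>x. (\<lambda>(t, x). V e t x) (t, x))"
        by (rule continuous_on_compose2[OF V_cont[OF that]]) (use t t0 in \<open>auto intro!: continuous_intros\<close>)
      then show ?thesis by (auto intro!: continuous_intros)
    qed
    have ge: "0 \<le> integral {0..?l e} (\<lambda>x. max 0 (V e t x))" if "e \<in> ?E" for e
      by (rule Henstock_Kurzweil_Integration.integral_nonneg)
        (use c[OF that] in \<open>auto intro: integrable_continuous_real\<close>)
    \<comment> \<open>The integral on each edge lies between 0 and \<open>M t\<close>, hence is 0,
      and a continuous nonnegative integrand with zero integral vanishes everywhere.\<close>
    have "M t \<le> 0" using M_le[OF t] \<open>M 0 = 0\<close> by simp
    moreover have "integral {0..?l e} (\<lambda>x. max 0 (V e t x)) \<le> M t"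
      unfolding M_def by (rule member_le_sum) (use e ge finE in auto)
    ultimately have "integral {0..?l e} (\<lambda>x. max 0 (V e t x)) = 0"
      using ge[OF e] by linarith
    then have "max 0 (V e t x) = 0"
      using integral_eq_0_iff[OF c[OF e]] net(3)[OF e] x by auto
    then show "\<rho>2 e t x \<le> \<rho>1 e t x" by (simp add: V_def max_def split: if_splits)
  qed
qed

end
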